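(* Let $H$ be a real Hilbert space, let $P$ be an orthogonal projector in $H$ with null-space $\mathbf N$ and range $\mathbf P=\mathbf N^\perp$, let $P^\perp=I-P$, and let $A:H\to H$ be a bounded linear operator with $A=A^*\ge 0$. The following statements are equivalent: 1. The subspace $\mathbf R(A)+\mathbf P$ is closed. 2. The subspace $A\mathbf N+\mathbf P$ is closed. 3. The subspace $P^\perp\mathbf R(A)$ is closed. 4. The subspace $P^\perp A\mathbf N$ is closed. 5. The problem of finding $\sigma\in H$ with $(P^\perp A+P)\sigma=P^\perp g+Pf$, for $f\in H$ and $g\in\mathbf R(A)+\mathbf P$, is well-posed in the factor-space: there is a constant $c$ such that for all such $f,g$ the solution $\sigma$ satisfies $\|\sigma\|_{H/(\mathbf N(A)\cap\mathbf N)}\le c(\|g\|+\|f\|)$; or, equivalently, $\|\sigma\|\le c(\|g\|+\|f\|)$ for the normal solution $\sigma\in\overline{\mathbf R(A)+\mathbf P}$.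
   Context: $\mathbf R(A)$ and $\mathbf N(A)$ denote the range and the null-space of $A$; the symbol $\mathbf N$ without argument is the null-space of $P$. A "subspace" is a linear manifold, not necessarily closed. For a closed subspace $M\subseteq H$, the factor-space norm is $\|\sigma\|_{H/M}=\operatorname{dist}(\sigma,M)$, i.e. the norm of the orthogonal projection of $\sigma$ onto $M^\perp$. Well-posedness means stable dependence of the solution on the right-hand side, as expressed by the displayed estimate. For given $f,g$ for which a solution exists, the solution set is a coset of $\mathbf N(A)\cap\mathbf N$, and the normal solution is the solution of minimal norm, i.e. the unique solution lying in $(\mathbf N(A)\cap\mathbf N)^\perp=\overline{\mathbf R(A)+\mathbf P}$. *)

theory Defs
  imports "HOL-Analysis.Analysis"
begin

definition null_space :: "('a::real_vector \<Rightarrow> 'a) \<Rightarrow> 'a set" where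
  "null_space T = {x. T x = 0}"

text \<open>
  Symmetry is stated through the inner product, because the library constant \<^const>\<open>adjoint\<close> is a
  choice operator whose characteristic property is only established there for Euclidean spaces.
\<close>

definition selfadjoint :: "('a::real_inner \<Rightarrow> 'a) \<Rightarrow> bool" where
  "selfadjoint T \<longleftrightarrow> bounded_linear T \<and> (\<forall>x y. T x \<bullet> y = x \<bullet> T y)"

definition nonneg_op :: "('a::real_inner \<Rightarrow> 'a) \<Rightarrow> bool" where
  "nonneg_op T \<longleftrightarrow> (\<forall>x. 0 \<le> T x \<bullet> x)"

definition orthogonal_projector :: "('a::real_inner \<Rightarrow> 'a) \<Rightarrow> bool" where
  "orthogonal_projector P \<longleftrightarrow> selfadjoint P \<and> (\<forall>x. P (P x) = P x)"

definition co_proj :: "('a::real_vector \<Rightarrow> 'a) \<Rightarrow> 'a \<Rightarrow> 'a" where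
  "co_proj P x = x - P x"

definition solution :: "('a::real_vector \<Rightarrow> 'a) \<Rightarrow> ('a \<Rightarrow> 'a) \<Rightarrow> 'a \<Rightarrow> 'a \<Rightarrow> 'a \<Rightarrow> bool" where
  "solution A P f g \<sigma> \<longleftrightarrow> co_proj P (A \<sigma>) + P \<sigma> = co_proj P g + P f"

definition normal_solution ::
    "('a::real_normed_vector \<Rightarrow> 'a) \<Rightarrow> ('a \<Rightarrow> 'a) \<Rightarrow> 'a \<Rightarrow> 'a \<Rightarrow> 'a \<Rightarrow> bool" where
  "normal_solution A P f g \<sigma> \<longleftrightarrow>
     solution A P f g \<sigma> \<and> (\<forall>\<tau>. solution A P f g \<tau> \<longrightarrow> norm \<sigma> \<le> norm \<tau>)"

text \<open>
  The sum of two sets is the elementwise sum of \<^theory>\<open>HOL-Library.Set_Algebras\<close>.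
  Well-posedness is stability only: the bound is required of the solutions that exist, and solvability
  for every \<open>f\<close> and \<open>g\<close> is not part of it. The norm of the class of \<open>\<sigma>\<close> in the factor space
  by a closed subspace \<open>M\<close> is \<open>infdist \<sigma> M\<close>.
\<close>

definition well_posed_factor :: "('a::real_normed_vector \<Rightarrow> 'a) \<Rightarrow> ('a \<Rightarrow> 'a) \<Rightarrow> bool" where
  "well_posed_factor A P \<longleftrightarrow>
     (\<exists>c. \<forall>f. \<forall>g \<in> range A + range P. \<forall>\<sigma>. solution A P f g \<sigma> \<longrightarrow>
        infdist \<sigma> (null_space A \<inter> null_space P) \<le> c * (norm g + norm f))"

definition well_posed_normal :: "('a::real_normed_vector \<Rightarrow> 'a) \<Rightarrow> ('a \<Rightarrow> 'a) \<Rightarrow> bool" where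
  "well_posed_normal A P \<longleftrightarrow>
     (\<exists>c. \<forall>f. \<forall>g \<in> range A + range P. \<forall>\<sigma>. normal_solution A P f g \<sigma> \<longrightarrow>
        norm \<sigma> \<le> c * (norm g + norm f))"

end

theory Submission
  imports Defs
begin

text \<open>
  Put \<open>Q = co_proj P\<close>, let \<open>K\<close> be the intersection of the null-spaces of \<open>A\<close> and \<open>P\<close>, and let
  \<open>T = Q A Q\<close> be the compression of \<open>A\<close> to the null-space of \<open>P\<close>. Every condition of the theorem is
  equivalent to closedness of the range of \<open>T\<close>.

  Adding the range of \<open>P\<close> to a set \<open>S\<close> gives the preimage of \<open>Q S\<close> under \<open>Q\<close>, and \<open>Q S\<close> is recovered
  from the sum by intersecting it with the null-space of \<open>P\<close>. Hence \<open>S + range P\<close> is closed exactly if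
  \<open>Q S\<close> is (\<open>closed_plus_range_projector_iff\<close>). This reduces the first four conditions to closedness
  of the ranges of \<open>Q A\<close> and of \<open>T\<close>.

  To compare these two ranges, positivity of \<open>A\<close> is used in the form
  \<open>\<parallel>A x\<parallel>\<^sup>2 \<le> \<parallel>A\<parallel> (A x \<bullet> x)\<close> (\<open>nonneg_op_norm_square_le\<close>). It shows that \<open>T\<close> and \<open>A Q\<close>, the adjoint
  of \<open>Q A\<close>, have the same null-space. If the range of \<open>T\<close> is closed, it is therefore the
  orthogonal complement of the null-space of \<open>A Q\<close>, which contains the range of \<open>Q A\<close>; so the two
  ranges coincide. Conversely, if the range of \<open>Q A\<close> is closed, then \<open>A Q\<close> is bounded below
  modulo its null-space (\<open>closed_range_imp_adjoint_bounded_below\<close>, a consequence of the uniform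
  boundedness principle). By positivity the quadratic form of \<open>T\<close> dominates \<open>\<parallel>A Q x\<parallel>\<^sup>2\<close> up to a
  constant, so \<open>T\<close> is bounded below modulo the same null-space and has closed range.

  Well-posedness is also a lower bound for \<open>T\<close>. A solution is determined modulo \<open>K\<close> by
  \<open>Q A \<sigma> = Q g\<close> and \<open>P \<sigma> = P f\<close>; the data \<open>f = 0\<close>, \<open>g = T x\<close> turn the stability estimate into the
  lower bound, and subtracting the known part \<open>P f\<close> from a solution turns the lower bound into the
  stability estimate. Finally, minimality of the norm within \<open>\<sigma> + K\<close> means orthogonality to
  \<open>K\<close>, and \<open>K\<close> is the orthogonal complement of \<open>range A + range P\<close>, so that the normal solution is
  the one in the closure of that subspace.
\<close>

section \<open>Orthogonal complements in Hilbert spaces\<close>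

lemma orthogonal_comp_iff: "x \<in> M\<^sup>\<bottom> \<longleftrightarrow> (\<forall>y\<in>M. x \<bullet> y = 0)"
  by (auto simp: orthogonal_comp_def orthogonal_def inner_commute)

lemma inner_eq_0_if_norm_minimal:
  fixes z m :: "'a::real_inner"
  assumes "\<And>t. norm z \<le> norm (z - t *\<^sub>R m)"
  shows "z \<bullet> m = 0"
proof (cases "m = 0")
  case False
  \<comment> \<open>This \<open>t\<close> minimises the norm: \<open>t *\<^sub>R m\<close> is the projection of \<open>z\<close> onto the line through \<open>m\<close>.\<close>
  define t where "t = (z \<bullet> m) / (m \<bullet> m)"
  have mm: "m \<bullet> m > 0" using False by simp
  have "(norm z)\<^sup>2 \<le> (norm (z - t *\<^sub>R m))\<^sup>2"
    using assms[of t] by (simp add: power_mono)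
  also have "\<dots> = z \<bullet> z - 2 * t * (z \<bullet> m) + t * t * (m \<bullet> m)"
    by (simp add: power2_norm_eq_inner inner_diff_left inner_diff_right inner_commute algebra_simps)
  also have "\<dots> = z \<bullet> z - (z \<bullet> m)\<^sup>2 / (m \<bullet> m)"
    using mm by (simp add: t_def field_simps power2_eq_square)
  finally have "(z \<bullet> m)\<^sup>2 / (m \<bullet> m) \<le> 0" by (simp add: power2_norm_eq_inner)
  hence "(z \<bullet> m)\<^sup>2 \<le> 0" using mm by (simp add: divide_le_0_iff)
  thus ?thesis by simp
qed simp

lemma norm_le_norm_add_orthogonal:
  fixes x y :: "'a::real_inner"
  assumes "x \<bullet> y = 0"
  shows "norm x \<le> norm (x + y)"
proof -
  have "(norm (x + y))\<^sup>2 = (norm x)\<^sup>2 + (norm y)\<^sup>2"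
    using assms by (simp add: power2_norm_eq_inner inner_add_left inner_add_right inner_commute)
  hence "(norm x)\<^sup>2 \<le> (norm (x + y))\<^sup>2" by simp
  thus ?thesis by simp
qed

lemma infdist_orthogonal_decomposition:
  fixes M :: "'a::real_inner set"
  assumes M: "subspace M" and m: "m \<in> M" and x: "x - m \<in> M\<^sup>\<bottom>"
  shows "infdist x M = norm (x - m)"
proof (rule antisym)
  show "infdist x M \<le> norm (x - m)" using infdist_le[OF m, of x] by (simp add: dist_norm)
  have "norm (x - m) \<le> dist x y" if y: "y \<in> M" for y
  proof -
    have "(x - m) \<bullet> (m - y) = 0"
      using x subspace_diff[OF M m y] by (simp add: orthogonal_comp_iff)
    from norm_le_norm_add_orthogonal[OF this] show ?thesis by (simp add: dist_norm)
  qed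
  moreover have "M \<noteq> {}" using m by blast
  ultimately show "norm (x - m) \<le> infdist x M"
    by (simp add: infdist_notempty cINF_greatest)
qed

text \<open>
  A sequence in \<open>M\<close> that minimises the distance to \<open>x\<close> is Cauchy by the parallelogram law, because
  midpoints of its members lie in \<open>M\<close> and cannot be closer to \<open>x\<close> than the distance. Its limit is a
  best approximation, and minimality forces the error to be orthogonal to \<open>M\<close>.
\<close>

lemma orthogonal_decomposition:
  fixes M :: "'a::{real_inner, complete_space} set"
  assumes M: "subspace M" "closed M"
  obtains m where "m \<in> M" "x - m \<in> M\<^sup>\<bottom>"
proof -
  define d where "d = infdist x M"
  have ne: "M \<noteq> {}" using M(1) subspace_0 by blast
  have d0: "d \<ge> 0" by (simp add: d_def infdist_nonneg)
  have dle: "d \<le> norm (x - y)" if "y \<in> M" for y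
    using infdist_le[OF that, of x] by (simp add: d_def dist_norm)
  have "\<exists>y\<in>M. norm (x - y) < d + inverse (real (Suc n))" for n
  proof (rule ccontr)
    assume "\<not> ?thesis"
    hence "d + inverse (real (Suc n)) \<le> (INF y\<in>M. dist x y)"
      using ne by (intro cINF_greatest) (auto simp: dist_norm not_less)
    thus False using ne by (simp add: d_def infdist_notempty)
  qed
  then obtain y where yM: "\<And>n. y n \<in> M" and y: "\<And>n. norm (x - y n) < d + inverse (real (Suc n))"
    by metis
  have gap: "(norm (y m - y n))\<^sup>2 \<le> 4 * (2 * d + 1) * inverse (real (Suc N))"
    if "m \<ge> N" "n \<ge> N" for m n N
  proof -
    define e where "e = inverse (real (Suc N))"
    have e: "0 < e" "e \<le> 1" by (auto simp: e_def field_simps)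
    have bd: "(norm (x - y k))\<^sup>2 \<le> d\<^sup>2 + (2 * d + 1) * e" if "k \<ge> N" for k
    proof -
      have "inverse (real (Suc k)) \<le> e" unfolding e_def using that by (simp add: field_simps)
      hence "norm (x - y k) \<le> d + e" using y[of k] by linarith
      hence "(norm (x - y k))\<^sup>2 \<le> (d + e)\<^sup>2" by (simp add: power_mono)
      also have "\<dots> = d\<^sup>2 + 2 * d * e + e * e" by (simp add: power2_eq_square algebra_simps)
      also have "\<dots> \<le> d\<^sup>2 + 2 * d * e + e" using e by (simp add: mult_left_le)
      finally show ?thesis by (simp add: algebra_simps)
    qed
    have "(1/2) *\<^sub>R (y m + y n) \<in> M" using M(1) yM by (simp add: subspace_add subspace_scale)
    hence "d \<le> norm (x - (1/2) *\<^sub>R (y m + y n))" by (rule dle)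
    hence "d\<^sup>2 \<le> (norm (x - (1/2) *\<^sub>R (y m + y n)))\<^sup>2" using d0 by (simp add: power_mono)
    moreover
    \<comment> \<open>The parallelogram law for \<open>x - y m\<close> and \<open>x - y n\<close>.\<close>
    have "(norm (y m - y n))\<^sup>2 = 2 * (norm (x - y m))\<^sup>2 + 2 * (norm (x - y n))\<^sup>2
        - 4 * (norm (x - (1/2) *\<^sub>R (y m + y n)))\<^sup>2"
      by (simp add: power2_norm_eq_inner inner_diff_left inner_diff_right inner_add_left
          inner_add_right inner_commute algebra_simps)
    ultimately have "(norm (y m - y n))\<^sup>2 \<le> 4 * ((2 * d + 1) * e)"
      using bd[OF that(1)] bd[OF that(2)] by linarith
    thus ?thesis by (simp only: e_def mult.assoc)
  qed
  have "Cauchy y"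
  proof (rule metric_CauchyI)
    fix e :: real assume e: "e > 0"
    have "(\<lambda>N. 4 * (2 * d + 1) * inverse (real (Suc N))) \<longlonglongrightarrow> 4 * (2 * d + 1) * 0"
      by (intro tendsto_intros LIMSEQ_inverse_real_of_nat)
    hence "\<forall>\<^sub>F N in sequentially. 4 * (2 * d + 1) * inverse (real (Suc N)) < e\<^sup>2"
      using e by (intro order_tendstoD(2)) auto
    then obtain N where N: "4 * (2 * d + 1) * inverse (real (Suc N)) < e\<^sup>2"
      by (auto simp: eventually_sequentially)
    have "dist (y m) (y n) < e" if "m \<ge> N" "n \<ge> N" for m n
    proof -
      have "(norm (y m - y n))\<^sup>2 < e\<^sup>2" using gap[OF that] N by linarith
      thus ?thesis using e by (simp add: dist_norm power_less_imp_less_base)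
    qed
    thus "\<exists>N. \<forall>m\<ge>N. \<forall>n\<ge>N. dist (y m) (y n) < e" by blast
  qed
  then obtain m where m: "y \<longlonglongrightarrow> m" using Cauchy_convergent_iff convergent_def by blast
  have mM: "m \<in> M" using closed_sequentially[OF M(2) _ m] yM by blast
  have "norm (x - m) \<le> d"
  proof (rule LIMSEQ_le)
    show "(\<lambda>n. norm (x - y n)) \<longlonglongrightarrow> norm (x - m)" by (intro tendsto_intros m)
    show "(\<lambda>n. d + inverse (real (Suc n))) \<longlonglongrightarrow> d"
      using tendsto_add[OF tendsto_const LIMSEQ_inverse_real_of_nat, of d] by simp
  qed (use y less_imp_le in blast)
  hence "norm (x - m) \<le> norm ((x - m) - t *\<^sub>R v)" if "v \<in> M" for t v
    using dle[of "m + t *\<^sub>R v"] M(1) mM that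
    by (simp add: subspace_add subspace_scale diff_diff_eq)
  hence "x - m \<in> M\<^sup>\<bottom>"
    by (auto simp: orthogonal_comp_iff intro: inner_eq_0_if_norm_minimal)
  with mM show ?thesis by (rule that)
qed

lemma closed_orthogonal_comp: "closed (M\<^sup>\<bottom>)" for M :: "'a::real_inner set"
proof -
  have "M\<^sup>\<bottom> = (\<Inter>y\<in>M. {x. x \<bullet> y = 0})" by (auto simp: orthogonal_comp_iff)
  thus ?thesis by (auto intro!: closed_INT closed_Collect_eq continuous_intros)
qed

lemma orthogonal_comp_comp_closed:
  fixes M :: "'a::{real_inner, complete_space} set"
  assumes "subspace M" "closed M"
  shows "M\<^sup>\<bottom>\<^sup>\<bottom> = M"
proof
  show "M\<^sup>\<bottom>\<^sup>\<bottom> \<subseteq> M"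
  proof
    fix x assume x: "x \<in> M\<^sup>\<bottom>\<^sup>\<bottom>"
    obtain m where m: "m \<in> M" "x - m \<in> M\<^sup>\<bottom>" using orthogonal_decomposition[OF assms] .
    have "x \<bullet> (x - m) = 0" "(x - m) \<bullet> m = 0" using x m by (auto simp: orthogonal_comp_iff)
    hence "(x - m) \<bullet> (x - m) = 0" by (simp add: inner_diff_left inner_diff_right inner_commute)
    thus "x \<in> M" using m by simp
  qed
qed (rule orthogonal_comp_subset)

lemma subspace_closure:
  fixes M :: "'a::real_normed_vector set"
  assumes M: "subspace M"
  shows "subspace (closure M)"
proof (rule subspaceI)
  show "0 \<in> closure M" using closure_subset subspace_0[OF M] by blast
next
  fix x y assume "x \<in> closure M" "y \<in> closure M"
  then obtain a b where "\<And>n. a n \<in> M" "a \<longlonglongrightarrow> x" "\<And>n. b n \<in> M" "b \<longlonglongrightarrow> y"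
    by (metis closure_sequential)
  then have "\<And>n. a n + b n \<in> M" "(\<lambda>n. a n + b n) \<longlonglongrightarrow> x + y"
    by (auto intro: subspace_add[OF M] tendsto_add)
  then show "x + y \<in> closure M" unfolding closure_sequential by (metis (no_types))
next
  fix c x assume "x \<in> closure M"
  then obtain a where "\<And>n. a n \<in> M" "a \<longlonglongrightarrow> x" by (metis closure_sequential)
  then have "\<And>n. c *\<^sub>R a n \<in> M" "(\<lambda>n. c *\<^sub>R a n) \<longlonglongrightarrow> c *\<^sub>R x"
    by (auto intro: subspace_scale[OF M] tendsto_scaleR)
  then show "c *\<^sub>R x \<in> closure M" unfolding closure_sequential by (metis (no_types))
qed

lemma closure_eq_orthogonal_comp_comp:
  fixes M :: "'a::{real_inner, complete_space} set"
  assumes "subspace M"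
  shows "closure M = M\<^sup>\<bottom>\<^sup>\<bottom>"
proof
  show "closure M \<subseteq> M\<^sup>\<bottom>\<^sup>\<bottom>"
    by (intro closure_minimal orthogonal_comp_subset closed_orthogonal_comp)
  have "M\<^sup>\<bottom>\<^sup>\<bottom> \<subseteq> (closure M)\<^sup>\<bottom>\<^sup>\<bottom>"
    by (intro orthogonal_comp_anti_mono closure_subset)
  thus "M\<^sup>\<bottom>\<^sup>\<bottom> \<subseteq> closure M"
    using assms by (simp add: orthogonal_comp_comp_closed subspace_closure)
qed

section \<open>Operators with closed range\<close>

lemma subspace_range_bounded_linear: "bounded_linear T \<Longrightarrow> subspace (range T)"
  by (simp add: bounded_linear.linear linear_subspace_image)

lemma subspace_null_space: "bounded_linear T \<Longrightarrow> subspace (null_space T)"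
  by (simp add: null_space_def bounded_linear.linear linear_subspace_kernel)

lemma closed_null_space: "bounded_linear T \<Longrightarrow> closed (null_space T)"
  unfolding null_space_def
  by (intro closed_Collect_eq continuous_on_const linear_continuous_on)

text \<open>
  The uniform boundedness principle for the functionals given by the members of \<open>S\<close>. The sets
  \<open>F n\<close> of vectors on which all of them are at most \<open>n\<close> in modulus are closed and cover the space, so
  one of them contains a ball by Baire's theorem. A bound on a ball bounds the norms.
\<close>

lemma weakly_bounded_imp_bounded:
  fixes S :: "'a::{real_inner, complete_space} set"
  assumes "\<And>y. \<exists>b. \<forall>x\<in>S. \<bar>x \<bullet> y\<bar> \<le> b"
  shows "bounded S"
proof -
  define F where "F n = {y. \<forall>x\<in>S. \<bar>x \<bullet> y\<bar> \<le> real n}" for n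
  have F: "F n = (\<Inter>x\<in>S. {y. \<bar>x \<bullet> y\<bar> \<le> real n})" for n by (auto simp: F_def)
  have cl: "closed (F n)" for n
    unfolding F by (intro closed_INT ballI closed_Collect_le continuous_intros)
  have cover: "(\<Union>n. F n) = UNIV"
  proof (intro set_eqI iffI UNIV_I)
    fix y
    obtain b where b: "\<forall>x\<in>S. \<bar>x \<bullet> y\<bar> \<le> b" using assms by blast
    obtain n where "b \<le> real n" using real_arch_simple by blast
    with b have "y \<in> F n" by (force simp: F_def)
    thus "y \<in> (\<Union>n. F n)" by blast
  qed
  have "\<exists>n. interior (F n) \<noteq> {}"
  proof (rule ccontr)
    assume "\<not> ?thesis"
    hence "euclidean interior_of \<Union>(range F) = {}"
      using cl by (intro Baire_category_alt) (auto simp: completely_metrizable_space_euclidean)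
    with cover show False by simp
  qed
  then obtain n y0 where "y0 \<in> interior (F n)" by blast
  then obtain r where r: "r > 0" "cball y0 r \<subseteq> F n" by (auto simp: mem_interior_cball)
  have "norm x \<le> 2 * real n / r" if x: "x \<in> S" for x
  proof (cases "x = 0")
    case False
    \<comment> \<open>The direction in which the functional of \<open>x\<close> grows fastest, scaled to stay in the ball.\<close>
    define z where "z = (r / norm x) *\<^sub>R x"
    have "norm z = r" using False r by (simp add: z_def)
    hence "y0 + z \<in> F n" "y0 \<in> F n" using r by (auto simp: dist_norm subset_iff)
    hence "\<bar>x \<bullet> (y0 + z)\<bar> \<le> real n" "\<bar>x \<bullet> y0\<bar> \<le> real n" using x by (auto simp: F_def)
    hence "x \<bullet> z \<le> 2 * real n" by (simp add: inner_add_right)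
    moreover have "x \<bullet> z = r * norm x"
      using False by (simp add: z_def dot_square_norm power2_eq_square)
    ultimately show ?thesis using r by (simp add: field_simps)
  qed (use r in simp)
  thus ?thesis by (auto simp: bounded_iff)
qed

text \<open>
  The half of the closed range theorem that rests on uniform boundedness. On the closed range of \<open>B\<close>
  consider the set \<open>S\<close> where \<open>\<parallel>B' x\<parallel> \<le> 1\<close>. It is weakly bounded: only the component \<open>B z\<close> of a
  test vector \<open>y\<close> matters, and \<open>x \<bullet> B z = B' x \<bullet> z\<close> is at most \<open>\<parallel>z\<parallel>\<close>. So \<open>S\<close> is bounded, which is the
  required lower bound for \<open>B'\<close> on the complement of its null-space. Measuring \<open>x\<close> by its distance
  to the null-space expresses this bound for all \<open>x\<close> at once.
\<close>

lemma closed_range_imp_adjoint_bounded_below: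
  fixes B B' :: "'a::{real_inner, complete_space} \<Rightarrow> 'a"
  assumes B: "bounded_linear B" and B': "bounded_linear B'"
    and adj: "\<And>x y. B x \<bullet> y = x \<bullet> B' y"
    and cl: "closed (range B)"
  shows "\<exists>c. \<forall>x. infdist x (null_space B') \<le> c * norm (B' x)"
proof -
  interpret B': bounded_linear B' by fact
  have sub: "subspace (range B)" by (rule subspace_range_bounded_linear[OF B])
  have perp: "B' k = 0" if "k \<in> (range B)\<^sup>\<bottom>" for k
  proof -
    have "B' k \<bullet> B' k = 0"
      using that adj[of "B' k" k] by (simp add: orthogonal_comp_iff inner_commute)
    thus ?thesis by simp
  qed
  define S where "S = {x \<in> range B. norm (B' x) \<le> 1}"
  have "bounded S"
  proof (rule weakly_bounded_imp_bounded)
    fix y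
    obtain z where z: "y - B z \<in> (range B)\<^sup>\<bottom>"
      using orthogonal_decomposition[OF sub cl, of y] by (metis rangeE)
    have "\<bar>x \<bullet> y\<bar> \<le> norm z" if x: "x \<in> S" for x
    proof -
      have "(y - B z) \<bullet> x = 0" using z x unfolding orthogonal_comp_iff S_def by blast
      hence "x \<bullet> y = B z \<bullet> x" by (simp add: inner_diff_left inner_commute[of y x])
      also have "\<dots> = z \<bullet> B' x" by (rule adj)
      finally have "x \<bullet> y = z \<bullet> B' x" .
      hence "\<bar>x \<bullet> y\<bar> \<le> norm z * norm (B' x)" by (simp add: Cauchy_Schwarz_ineq2)
      also have "\<dots> \<le> norm z * 1" using x by (intro mult_left_mono) (auto simp: S_def)
      finally show ?thesis by simp
    qed
    thus "\<exists>b. \<forall>x\<in>S. \<bar>x \<bullet> y\<bar> \<le> b" by blast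
  qed
  then obtain c where c: "\<And>x. x \<in> S \<Longrightarrow> norm x \<le> c" by (auto simp: bounded_iff)
  have "infdist x (null_space B') \<le> c * norm (B' x)" for x
  proof -
    obtain m where m: "m \<in> range B" "x - m \<in> (range B)\<^sup>\<bottom>"
      using orthogonal_decomposition[OF sub cl] .
    have eq: "B' x = B' m" using perp[OF m(2)] by (simp add: B'.diff)
    have "x - m \<in> null_space B'" using perp[OF m(2)] by (simp add: null_space_def)
    from infdist_le[OF this, of x] have le: "infdist x (null_space B') \<le> norm m"
      by (simp add: dist_norm)
    show ?thesis
    proof (cases "B' m = 0")
      case True
      obtain z where "m = B z" using m by blast
      with adj[of z m] True have "m = 0" by simp
      with le True eq show ?thesis by simp
    next
      case False
      have "(1 / norm (B' m)) *\<^sub>R m \<in> S"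
        using False subspace_scale[OF sub m(1)] by (auto simp: S_def B'.scaleR)
      from c[OF this] have "norm m \<le> c * norm (B' m)" using False by (simp add: field_simps)
      with le eq show ?thesis by simp
    qed
  qed
  thus ?thesis by blast
qed

text \<open>
  The range of \<open>T\<close> is already attained on the complement of its null-space. There the bound holds
  with the norm itself, and the image of a complete subspace under an operator bounded below is complete.
\<close>

lemma bounded_below_imp_closed_range:
  fixes T :: "'a::{real_inner, complete_space} \<Rightarrow> 'a"
  assumes T: "bounded_linear T"
    and bound: "\<And>x. infdist x (null_space T) \<le> c * norm (T x)"
  shows "closed (range T)"
proof -
  interpret bounded_linear T by fact
  let ?N = "null_space T"
  have N: "subspace ?N" "closed ?N" using T by (simp_all add: subspace_null_space closed_null_space)
  have "range T \<subseteq> T ` (?N\<^sup>\<bottom>)"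
  proof clarify
    fix x
    obtain k where k: "k \<in> ?N" "x - k \<in> ?N\<^sup>\<bottom>" using orthogonal_decomposition[OF N] .
    have "T x = T (x - k)" using k(1) by (simp add: null_space_def diff)
    thus "T x \<in> T ` (?N\<^sup>\<bottom>)" using k(2) by blast
  qed
  hence eq: "range T = T ` (?N\<^sup>\<bottom>)" by blast
  have "complete (T ` (?N\<^sup>\<bottom>))"
  proof (rule complete_isometric_image)
    \<comment> \<open>The given \<open>c\<close> may be zero or negative, hence the shift to \<open>\<bar>c\<bar> + 1\<close>.\<close>
    show "0 < 1 / (\<bar>c\<bar> + 1)" by simp
    show "\<forall>x\<in>?N\<^sup>\<bottom>. 1 / (\<bar>c\<bar> + 1) * norm x \<le> norm (T x)"
    proof
      fix x assume "x \<in> ?N\<^sup>\<bottom>"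
      hence "norm x = infdist x ?N"
        using infdist_orthogonal_decomposition[of ?N 0 x] N by (simp add: subspace_0)
      also have "\<dots> \<le> (\<bar>c\<bar> + 1) * norm (T x)"
        using bound[of x] by (rule order_trans) (intro mult_right_mono, auto)
      finally show "1 / (\<bar>c\<bar> + 1) * norm x \<le> norm (T x)" by (simp add: field_simps)
    qed
  qed (use T in \<open>auto simp: subspace_orthogonal_comp closed_orthogonal_comp complete_eq_closed\<close>)
  thus ?thesis by (simp add: eq complete_eq_closed)
qed

lemma selfadjointD:
  assumes "selfadjoint T"
  shows "bounded_linear T" "T x \<bullet> y = x \<bullet> T y"
  using assms unfolding selfadjoint_def by blast+

lemma selfadjoint_closed_range_iff:
  fixes T :: "'a::{real_inner, complete_space} \<Rightarrow> 'a"
  assumes "selfadjoint T"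
  shows "closed (range T) \<longleftrightarrow> (\<exists>c. \<forall>x. infdist x (null_space T) \<le> c * norm (T x))"
proof -
  note T = selfadjointD[OF assms]
  show ?thesis
    using closed_range_imp_adjoint_bounded_below[OF T(1) T(1) T(2)]
      bounded_below_imp_closed_range[OF T(1)] by blast
qed

text \<open>
  Positivity of the form of \<open>A\<close> at \<open>x - t *\<^sub>R A x\<close> gives a quadratic inequality in \<open>t\<close>. Its last
  coefficient is at most the norm of \<open>A\<close> times \<open>\<parallel>A x\<parallel>\<^sup>2\<close>, so the choice \<open>t = 1 / \<parallel>A\<parallel>\<close> yields the claim.
\<close>

lemma nonneg_op_norm_square_le:
  fixes A :: "'a::real_inner \<Rightarrow> 'a"
  assumes sa: "selfadjoint A" and nn: "nonneg_op A"
  shows "(norm (A x))\<^sup>2 \<le> onorm A * (A x \<bullet> x)"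
proof -
  note lin = selfadjointD(1)[OF sa] and sym = selfadjointD(2)[OF sa]
  interpret bounded_linear A by (rule lin)
  define a b where "a = A x \<bullet> x" and "b = A x \<bullet> A x"
  define M where "M = onorm A"
  have M0: "M \<ge> 0" unfolding M_def by (rule onorm_pos_le[OF lin])
  have "A (A x) \<bullet> A x \<le> norm (A (A x)) * norm (A x)" by (rule norm_cauchy_schwarz)
  also have "\<dots> \<le> M * norm (A x) * norm (A x)"
    unfolding M_def by (intro mult_right_mono onorm[OF lin]) auto
  finally have AA: "A (A x) \<bullet> A x \<le> M * b"
    by (simp add: b_def dot_square_norm power2_eq_square)
  have quad: "2 * t * b \<le> a + t * t * (M * b)" for t
  proof -
    have "0 \<le> A (x - t *\<^sub>R A x) \<bullet> (x - t *\<^sub>R A x)" using nn by (simp add: nonneg_op_def)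
    also have "\<dots> = a - 2 * t * b + t * t * (A (A x) \<bullet> A x)"
      using sym[of "A x" x]
      by (simp add: diff scaleR inner_diff_left inner_diff_right a_def b_def algebra_simps)
    also have "\<dots> \<le> a - 2 * t * b + t * t * (M * b)"
      using AA by (intro add_left_mono mult_left_mono) auto
    finally show ?thesis by simp
  qed
  have "b \<le> M * a"
  proof (cases "M = 0")
    case True
    have "A x = 0" using onorm[OF lin, of x] True by (simp add: M_def)
    thus ?thesis using True by (simp add: b_def)
  next
    case False
    hence "M > 0" using M0 by simp
    with quad[of "1 / M"] show ?thesis by (simp add: field_simps)
  qed
  thus ?thesis by (simp add: a_def b_def M_def power2_norm_eq_inner)
qed

section \<open>Projectors and the compression of an operator\<close>

lemma orthogonal_projectorD:
  assumes "orthogonal_projector P"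
  shows "bounded_linear P" "P x \<bullet> y = x \<bullet> P y" "P (P x) = P x"
  using assms unfolding orthogonal_projector_def selfadjoint_def by blast+

lemma orthogonal_projector_co_proj:
  assumes "orthogonal_projector P"
  shows "orthogonal_projector (co_proj P)"
proof -
  note P = orthogonal_projectorD[OF assms]
  have "co_proj P = (\<lambda>x. x - P x)" by (simp add: fun_eq_iff co_proj_def)
  hence "bounded_linear (co_proj P)" using P(1) by (simp add: bounded_linear_sub bounded_linear_ident)
  moreover have "co_proj P x \<bullet> y = x \<bullet> co_proj P y" for x y
    using P(2)[of x y] by (simp add: co_proj_def inner_diff_left inner_diff_right)
  moreover have "co_proj P (co_proj P x) = co_proj P x" for x
    using P(3) by (simp add: co_proj_def linear_diff bounded_linear.linear[OF P(1)])
  ultimately show ?thesis unfolding orthogonal_projector_def selfadjoint_def by blast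
qed

lemma norm_orthogonal_projector_le:
  assumes "orthogonal_projector P"
  shows "norm (P x) \<le> norm x"
proof -
  note P = orthogonal_projectorD[OF assms]
  have "P x \<bullet> (x - P x) = 0"
    using P(2)[of x "P x"] P(2)[of "P x" x] P(3)[of x] by (simp add: inner_diff_right)
  from norm_le_norm_add_orthogonal[OF this] show ?thesis by simp
qed

lemma projector_co_proj:
  assumes "orthogonal_projector P"
  shows "P (co_proj P x) = 0" "co_proj P (P x) = 0" "P x + co_proj P x = x"
  using orthogonal_projectorD(3)[OF assms]
  by (simp_all add: co_proj_def linear_diff
      bounded_linear.linear[OF orthogonal_projectorD(1)[OF assms]])

lemma co_proj_eq_self_iff: "co_proj P x = x \<longleftrightarrow> x \<in> null_space P"
  by (simp add: co_proj_def null_space_def)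

lemma range_co_proj:
  assumes "orthogonal_projector P"
  shows "range (co_proj P) = null_space P"
proof
  show "range (co_proj P) \<subseteq> null_space P"
    using projector_co_proj(1)[OF assms] by (auto simp: null_space_def)
  show "null_space P \<subseteq> range (co_proj P)"
    using co_proj_eq_self_iff[of P] by (metis rangeI subsetI)
qed

text \<open>
  \<open>S + range P\<close> is the preimage of \<open>Q S\<close> under the continuous map \<open>Q = co_proj P\<close>, and \<open>Q S\<close> is the
  trace of \<open>S + range P\<close> on the closed null-space of \<open>P\<close>; so closedness passes both ways.
\<close>

lemma closed_plus_range_projector_iff:
  assumes P: "orthogonal_projector P"
  shows "closed (S + range P) \<longleftrightarrow> closed (co_proj P ` S)"
proof -
  let ?Q = "co_proj P"
  note Q = orthogonal_projector_co_proj[OF P]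
  interpret Q: bounded_linear ?Q by (rule orthogonal_projectorD(1)[OF Q])
  have preimage: "S + range P = ?Q -` (?Q ` S)"
  proof (intro set_eqI iffI)
    fix x assume "x \<in> S + range P"
    then obtain s y where "s \<in> S" "x = s + P y" by (auto simp: set_plus_def)
    hence "?Q x = ?Q s" by (simp add: Q.add projector_co_proj[OF P])
    thus "x \<in> ?Q -` (?Q ` S)" using \<open>s \<in> S\<close> by auto
  next
    fix x assume "x \<in> ?Q -` (?Q ` S)"
    then obtain s where s: "s \<in> S" "?Q x = ?Q s" by auto
    have "x - s = P (x - s)" using s(2) by (metis Q.diff co_proj_def eq_iff_diff_eq_0)
    hence "x = s + P (x - s)" by (simp add: algebra_simps)
    thus "x \<in> S + range P" using s(1) by (metis rangeI set_plus_intro)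
  qed
  have trace: "?Q ` S = (S + range P) \<inter> null_space P"
  proof -
    have "?Q s \<in> S + range P" if "s \<in> S" for s
      using that orthogonal_projectorD(3)[OF Q] by (auto simp: preimage)
    moreover have "x \<in> ?Q ` S" if "x \<in> S + range P" "x \<in> null_space P" for x
      using that co_proj_eq_self_iff[of P x] by (simp add: preimage)
    ultimately show ?thesis using range_co_proj[OF P] by blast
  qed
  show ?thesis
  proof
    assume "closed (S + range P)"
    thus "closed (?Q ` S)"
      unfolding trace by (intro closed_Int closed_null_space orthogonal_projectorD(1)[OF P])
  next
    assume "closed (?Q ` S)"
    thus "closed (S + range P)"
      unfolding preimage by (intro closed_vimage Q.continuous_on continuous_on_id)
  qed
qed

locale nonneg_op_with_projector =
  fixes P A :: "'h::{real_inner, complete_space} \<Rightarrow> 'h"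
  assumes P: "orthogonal_projector P"
    and A: "selfadjoint A"
    and A_nonneg: "nonneg_op A"
begin

abbreviation Q where "Q \<equiv> co_proj P"

abbreviation K where "K \<equiv> null_space A \<inter> null_space P"

definition T where "T x = Q (A (Q x))"

lemmas A_lin = selfadjointD(1)[OF A]
lemmas A_sym = selfadjointD(2)[OF A]
lemmas P_lin = orthogonal_projectorD(1)[OF P]
lemmas P_sym = orthogonal_projectorD(2)[OF P]
lemmas P_idem = orthogonal_projectorD(3)[OF P]
lemmas Q_proj = orthogonal_projector_co_proj[OF P]
lemmas Q_lin = orthogonal_projectorD(1)[OF Q_proj]
lemmas Q_sym = orthogonal_projectorD(2)[OF Q_proj]
lemmas Q_idem = orthogonal_projectorD(3)[OF Q_proj]
lemmas PQ = projector_co_proj[OF P]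

sublocale A: bounded_linear A by (rule A_lin)
sublocale P: bounded_linear P by (rule P_lin)
sublocale Q: bounded_linear Q by (rule Q_lin)

lemma QA_lin: "bounded_linear (\<lambda>x. Q (A x))"
  by (rule bounded_linear_compose[OF Q_lin A_lin])

lemma AQ_lin: "bounded_linear (\<lambda>x. A (Q x))"
  by (rule bounded_linear_compose[OF A_lin Q_lin])

lemma T_selfadjoint: "selfadjoint T"
proof -
  have "T = (\<lambda>x. Q (A (Q x)))" by (simp add: fun_eq_iff T_def)
  hence "bounded_linear T" using bounded_linear_compose[OF QA_lin Q_lin] by simp
  thus ?thesis unfolding selfadjoint_def by (simp add: T_def Q_sym A_sym)
qed

lemma range_T: "range T = Q ` A ` null_space P"
  unfolding range_co_proj[OF P, symmetric] by (auto simp: T_def)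

lemma norm_AQ_square_le: "(norm (A (Q x)))\<^sup>2 \<le> onorm A * (T x \<bullet> x)"
  using nonneg_op_norm_square_le[OF A A_nonneg, of "Q x"] by (simp add: T_def Q_sym)

lemma T_eq_0_iff: "T x = 0 \<longleftrightarrow> A (Q x) = 0"
  using norm_AQ_square_le[of x] by (auto simp: T_def)

text \<open>
  Identifies \<open>K\<close> as the null-space of the operator \<open>Q A + P\<close> of the problem: on the null-space of \<open>P\<close>
  the equation \<open>Q A x = 0\<close> says \<open>T x = 0\<close>, which forces \<open>A x = 0\<close> by positivity.
\<close>

lemma K_iff: "x \<in> K \<longleftrightarrow> Q (A x) = 0 \<and> P x = 0"
proof
  assume x: "Q (A x) = 0 \<and> P x = 0"
  hence "Q x = x" by (simp add: co_proj_def)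
  with x have "A x = 0" using T_eq_0_iff[of x] by (simp add: T_def)
  with x show "x \<in> K" by (simp add: null_space_def)
qed (auto simp: null_space_def)

lemma subspace_K: "subspace K" and closed_K: "closed K"
  by (simp_all add: subspace_inter subspace_null_space closed_Int closed_null_space A_lin P_lin)

text \<open>
  The operators \<open>A Q\<close> and \<open>Q A\<close> are adjoint, so closedness gives \<open>\<parallel>r\<parallel> \<le> c \<parallel>A Q r\<parallel>\<close> for \<open>r\<close> orthogonal to the
  common null-space of \<open>A Q\<close> and \<open>T\<close>. Together with \<open>\<parallel>A Q r\<parallel>\<^sup>2 \<le> \<parallel>A\<parallel> (T r \<bullet> r) \<le> \<parallel>A\<parallel> \<parallel>T r\<parallel> \<parallel>r\<parallel>\<close> this
  bounds \<open>\<parallel>r\<parallel>\<close> by a multiple of \<open>\<parallel>T r\<parallel>\<close>, one factor \<open>\<parallel>r\<parallel>\<close> cancelling.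
\<close>

lemma closed_range_T_if_closed_range_QA:
  assumes "closed (Q ` range A)"
  shows "closed (range T)"
proof -
  have "closed (range (\<lambda>x. Q (A x)))" using assms by (simp add: image_image)
  moreover have "Q (A x) \<bullet> y = x \<bullet> A (Q y)" for x y by (simp add: Q_sym A_sym)
  ultimately obtain c where c: "\<And>x. infdist x (null_space (\<lambda>x. A (Q x))) \<le> c * norm (A (Q x))"
    using closed_range_imp_adjoint_bounded_below[OF QA_lin AQ_lin] by blast
  have null: "null_space (\<lambda>x. A (Q x)) = null_space T" by (simp add: null_space_def T_eq_0_iff)
  have N: "subspace (null_space T)" "closed (null_space T)"
    by (simp_all add: subspace_null_space closed_null_space selfadjointD(1)[OF T_selfadjoint])
  have "infdist x (null_space T) \<le> (c\<^sup>2 * onorm A) * norm (T x)" for x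
  proof -
    obtain k where k: "k \<in> null_space T" "x - k \<in> (null_space T)\<^sup>\<bottom>"
      using orthogonal_decomposition[OF N] .
    define r where "r = x - k"
    have d: "infdist x (null_space T) = norm r"
      unfolding r_def by (rule infdist_orthogonal_decomposition[OF N(1) k])
    interpret T: bounded_linear T by (rule selfadjointD(1)[OF T_selfadjoint])
    have Tk: "T k = 0" using k(1) by (simp add: null_space_def)
    have "A (Q k) = 0" using Tk T_eq_0_iff by blast
    hence AQ: "A (Q x) = A (Q r)" by (simp add: r_def Q.diff A.diff)
    have Tr: "T x = T r" using Tk by (simp add: r_def T.diff)
    have "norm r \<le> c * norm (A (Q r))" using c[of x] by (simp add: null d AQ)
    hence "(norm r)\<^sup>2 \<le> (c * norm (A (Q r)))\<^sup>2" by (simp add: power_mono)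
    also have "\<dots> \<le> c\<^sup>2 * (onorm A * (T r \<bullet> r))"
      unfolding power_mult_distrib by (intro mult_left_mono norm_AQ_square_le) simp
    also have "\<dots> \<le> c\<^sup>2 * (onorm A * (norm (T r) * norm r))"
      by (intro mult_left_mono norm_cauchy_schwarz onorm_pos_le A_lin) simp
    finally have "norm r * norm r \<le> (c\<^sup>2 * onorm A * norm (T r)) * norm r"
      by (simp add: power2_eq_square mult.assoc)
    moreover have "0 \<le> c\<^sup>2 * onorm A * norm (T r)" by (simp add: onorm_pos_le A_lin)
    ultimately have "norm r \<le> c\<^sup>2 * onorm A * norm (T r)"
      by (cases "r = 0") auto
    thus ?thesis by (simp add: d Tr)
  qed
  thus ?thesis using selfadjoint_closed_range_iff[OF T_selfadjoint] by blast
qed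

text \<open>
  The range of \<open>Q A\<close> is orthogonal to the null-space of its adjoint \<open>A Q\<close>, which is that of \<open>T\<close>; hence
  it lies in the closure of the range of \<open>T\<close>. As it also contains that range, closedness of the
  latter makes the two equal.
\<close>

lemma closed_range_QA_if_closed_range_T:
  assumes "closed (range T)"
  shows "closed (Q ` range A)"
proof -
  note lin = selfadjointD(1)[OF T_selfadjoint] and sym = selfadjointD(2)[OF T_selfadjoint]
  have "Q (A z) \<in> (range T)\<^sup>\<bottom>\<^sup>\<bottom>" for z
    unfolding orthogonal_comp_iff
  proof
    fix y assume y: "y \<in> (range T)\<^sup>\<bottom>"
    have "T y \<bullet> T y = 0" using y sym[of y "T y"] by (simp add: orthogonal_comp_iff)
    hence "A (Q y) = 0" using T_eq_0_iff by simp
    thus "Q (A z) \<bullet> y = 0" by (simp add: Q_sym A_sym)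
  qed
  hence "Q ` range A \<subseteq> range T"
    using orthogonal_comp_comp_closed[OF subspace_range_bounded_linear[OF lin] assms] by auto
  moreover have "range T \<subseteq> Q ` range A" by (auto simp: T_def)
  ultimately show ?thesis using assms by simp
qed

section \<open>Solutions and well-posedness\<close>

text \<open>The two sides of the equation split along the complementary ranges of \<open>Q\<close> and \<open>P\<close>.\<close>

lemma solution_iff: "solution A P f g \<sigma> \<longleftrightarrow> Q (A \<sigma>) = Q g \<and> P \<sigma> = P f"
proof
  assume s: "solution A P f g \<sigma>"
  hence eq: "Q (A \<sigma>) + P \<sigma> = Q g + P f" by (simp add: solution_def)
  from arg_cong[OF eq, of P] have "P \<sigma> = P f" by (simp add: P.add PQ P_idem)
  with eq show "Q (A \<sigma>) = Q g \<and> P \<sigma> = P f" by simp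
qed (simp add: solution_def)

lemma solution_iff_diff_in_K:
  assumes "solution A P f g \<sigma>"
  shows "solution A P f g \<tau> \<longleftrightarrow> \<tau> - \<sigma> \<in> K"
  using assms unfolding solution_iff K_iff by (simp add: A.diff Q.diff P.diff)

text \<open>
  The solutions form the coset \<open>\<sigma> + K\<close>, and the shortest vector of a coset is the one orthogonal
  to the subspace.
\<close>

lemma normal_solution_iff_orthogonal:
  "normal_solution A P f g \<sigma> \<longleftrightarrow> solution A P f g \<sigma> \<and> \<sigma> \<in> K\<^sup>\<bottom>"
proof
  assume n: "normal_solution A P f g \<sigma>"
  hence s: "solution A P f g \<sigma>" by (simp add: normal_solution_def)
  have "\<sigma> \<bullet> k = 0" if k: "k \<in> K" for k
  proof (rule inner_eq_0_if_norm_minimal)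
    fix t
    have "(\<sigma> - t *\<^sub>R k) - \<sigma> \<in> K" using subspace_scale[OF subspace_K k, of "- t"] by simp
    hence "solution A P f g (\<sigma> - t *\<^sub>R k)" using solution_iff_diff_in_K[OF s] by blast
    thus "norm \<sigma> \<le> norm (\<sigma> - t *\<^sub>R k)" using n by (simp add: normal_solution_def)
  qed
  with s show "solution A P f g \<sigma> \<and> \<sigma> \<in> K\<^sup>\<bottom>" unfolding orthogonal_comp_iff by blast
next
  assume *: "solution A P f g \<sigma> \<and> \<sigma> \<in> K\<^sup>\<bottom>"
  have "norm \<sigma> \<le> norm \<tau>" if "solution A P f g \<tau>" for \<tau>
  proof -
    have "\<tau> - \<sigma> \<in> K" using * that solution_iff_diff_in_K by blast
    hence "\<sigma> \<bullet> (\<tau> - \<sigma>) = 0" using * unfolding orthogonal_comp_iff by blast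
    from norm_le_norm_add_orthogonal[OF this] show ?thesis by simp
  qed
  thus "normal_solution A P f g \<sigma>" using * by (simp add: normal_solution_def)
qed

lemma K_eq_orthogonal_comp: "K = (range A + range P)\<^sup>\<bottom>"
proof (intro set_eqI iffI)
  fix x assume "x \<in> K"
  hence "A x = 0" "P x = 0" by (auto simp: null_space_def)
  thus "x \<in> (range A + range P)\<^sup>\<bottom>"
    by (auto simp: orthogonal_comp_iff set_plus_def inner_add_right A_sym[symmetric] P_sym[symmetric])
next
  fix x assume x: "x \<in> (range A + range P)\<^sup>\<bottom>"
  have "A y + P z \<in> range A + range P" for y z by (auto intro: set_plus_intro)
  hence *: "x \<bullet> (A y + P z) = 0" for y z using x by (simp add: orthogonal_comp_iff)
  have "A x \<bullet> A x = 0" "P x \<bullet> P x = 0"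
    using *[of "A x" 0] *[of 0 "P x"] by (simp_all add: A_sym P_sym A.zero P.zero)
  thus "x \<in> K" by (simp add: null_space_def)
qed

lemma closure_range_plus: "closure (range A + range P) = K\<^sup>\<bottom>"
proof -
  have "range A + range P = {x + y |x y. x \<in> range A \<and> y \<in> range P}"
    by (auto simp: set_plus_def)
  hence "subspace (range A + range P)"
    using subspace_sums[OF subspace_range_bounded_linear[OF A_lin]
        subspace_range_bounded_linear[OF P_lin]] by simp
  thus ?thesis unfolding K_eq_orthogonal_comp by (rule closure_eq_orthogonal_comp_comp)
qed

text \<open>
  The component of a solution orthogonal to \<open>K\<close> is the normal solution of the same problem, and its
  norm is the distance of the solution from \<open>K\<close>.
\<close>

lemma well_posed_factor_iff_normal: "well_posed_factor A P \<longleftrightarrow> well_posed_normal A P"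
proof
  assume "well_posed_factor A P"
  then obtain c where c: "\<And>f g \<sigma>. g \<in> range A + range P \<Longrightarrow> solution A P f g \<sigma> \<Longrightarrow>
      infdist \<sigma> K \<le> c * (norm g + norm f)"
    unfolding well_posed_factor_def by blast
  have "norm \<sigma> \<le> c * (norm g + norm f)"
    if g: "g \<in> range A + range P" and n: "normal_solution A P f g \<sigma>" for f g \<sigma>
  proof -
    have s: "solution A P f g \<sigma>" and perp: "\<sigma> - 0 \<in> K\<^sup>\<bottom>"
      using n normal_solution_iff_orthogonal by auto
    have "infdist \<sigma> K = norm (\<sigma> - 0)"
      by (rule infdist_orthogonal_decomposition[OF subspace_K subspace_0[OF subspace_K] perp])
    with c[OF g s] show ?thesis by simp
  qed
  thus "well_posed_normal A P" unfolding well_posed_normal_def by blast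
next
  assume "well_posed_normal A P"
  then obtain c where c: "\<And>f g \<sigma>. g \<in> range A + range P \<Longrightarrow> normal_solution A P f g \<sigma> \<Longrightarrow>
      norm \<sigma> \<le> c * (norm g + norm f)"
    unfolding well_posed_normal_def by blast
  have "infdist \<sigma> K \<le> c * (norm g + norm f)"
    if g: "g \<in> range A + range P" and s: "solution A P f g \<sigma>" for f g \<sigma>
  proof -
    obtain k where k: "k \<in> K" "\<sigma> - k \<in> K\<^sup>\<bottom>"
      using orthogonal_decomposition[OF subspace_K closed_K] .
    have "(\<sigma> - k) - \<sigma> \<in> K" using subspace_neg[OF subspace_K k(1)] by simp
    hence "solution A P f g (\<sigma> - k)" using solution_iff_diff_in_K[OF s] by blast
    with k(2) have "normal_solution A P f g (\<sigma> - k)"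
      using normal_solution_iff_orthogonal by blast
    from c[OF g this] show ?thesis
      by (simp add: infdist_orthogonal_decomposition[OF subspace_K k])
  qed
  thus "well_posed_factor A P" unfolding well_posed_factor_def by blast
qed

text \<open>
  Both conditions are lower bounds. The null-space of \<open>T\<close> is \<open>K + range P\<close>, so the distance of \<open>x\<close> from
  it is the distance of \<open>Q x\<close> from \<open>K\<close>, and \<open>Q x\<close> solves the problem with \<open>f = 0\<close> and \<open>g = T x\<close>. Conversely,
  a solution satisfies \<open>T \<sigma> = Q (g - A (P f))\<close>, which controls its \<open>Q\<close>-part modulo \<open>K\<close>, while its
  \<open>P\<close>-part is \<open>P f\<close>.
\<close>

lemma well_posed_factor_iff_closed_range_T: "well_posed_factor A P \<longleftrightarrow> closed (range T)"
proof
  assume "well_posed_factor A P"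
  then obtain c where c: "\<And>f g \<sigma>. g \<in> range A + range P \<Longrightarrow> solution A P f g \<sigma> \<Longrightarrow>
      infdist \<sigma> K \<le> c * (norm g + norm f)"
    unfolding well_posed_factor_def by blast
  have "infdist x (null_space T) \<le> c * norm (T x)" for x
  proof -
    have "T x = A (Q x) + P (- A (Q x))" by (simp add: T_def co_proj_def P.neg)
    hence "T x \<in> range A + range P" by (metis rangeI set_plus_intro)
    moreover have "solution A P 0 (T x) (Q x)"
      by (simp add: solution_iff T_def Q_idem PQ P.zero)
    ultimately have le: "infdist (Q x) K \<le> c * norm (T x)" using c by fastforce
    obtain k where k: "k \<in> K" "Q x - k \<in> K\<^sup>\<bottom>"
      using orthogonal_decomposition[OF subspace_K closed_K] .
    have "Q k = k" "A k = 0" using k(1) by (auto simp: null_space_def co_proj_def)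
    hence "k + P x \<in> null_space T"
      by (simp add: null_space_def T_eq_0_iff Q.add PQ)
    from infdist_le[OF this, of x] have "infdist x (null_space T) \<le> norm (Q x - k)"
      by (simp add: dist_norm co_proj_def algebra_simps)
    also have "\<dots> = infdist (Q x) K"
      by (rule infdist_orthogonal_decomposition[OF subspace_K k, symmetric])
    finally show ?thesis using le by simp
  qed
  thus "closed (range T)" using selfadjoint_closed_range_iff[OF T_selfadjoint] by blast
next
  assume "closed (range T)"
  then obtain c where c: "\<And>x. infdist x (null_space T) \<le> c * norm (T x)"
    using selfadjoint_closed_range_iff[OF T_selfadjoint] by blast
  have N: "subspace (null_space T)" "closed (null_space T)"
    by (simp_all add: subspace_null_space closed_null_space selfadjointD(1)[OF T_selfadjoint])
  have "infdist \<sigma> K \<le> (1 + \<bar>c\<bar> * (1 + onorm A)) * (norm g + norm f)"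
    if s: "solution A P f g \<sigma>" for f g \<sigma>
  proof -
    have QA: "Q (A \<sigma>) = Q g" and Pf: "P \<sigma> = P f" using s by (auto simp: solution_iff)
    obtain k where k: "k \<in> null_space T" "\<sigma> - k \<in> (null_space T)\<^sup>\<bottom>"
      using orthogonal_decomposition[OF N] .
    have "Q k \<in> K" using k(1) by (simp add: null_space_def T_eq_0_iff PQ)
    from infdist_le[OF this, of \<sigma>] have "infdist \<sigma> K \<le> norm (P f + Q (\<sigma> - k))"
      using PQ(3)[of \<sigma>] Pf by (simp add: dist_norm Q.diff add_diff_eq)
    also have "\<dots> \<le> norm f + norm (\<sigma> - k)"
      by (intro norm_triangle_mono norm_orthogonal_projector_le P Q_proj)
    also have "norm (\<sigma> - k) \<le> c * norm (T \<sigma>)"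
      using c[of \<sigma>] by (simp add: infdist_orthogonal_decomposition[OF N(1) k])
    also have "\<dots> \<le> \<bar>c\<bar> * norm (T \<sigma>)" by (intro mult_right_mono) auto
    also have "T \<sigma> = Q (g - A (P f))"
      using QA Pf by (simp add: T_def co_proj_def[of P \<sigma>] A.diff Q.diff)
    also have "norm \<dots> \<le> norm (g - A (P f))" by (rule norm_orthogonal_projector_le[OF Q_proj])
    also have "\<dots> \<le> norm g + norm (A (P f))" by (rule norm_triangle_ineq4)
    also have "norm (A (P f)) \<le> onorm A * norm (P f)" by (rule onorm[OF A_lin])
    also have "\<dots> \<le> onorm A * norm f"
      by (intro mult_left_mono norm_orthogonal_projector_le P onorm_pos_le A_lin)
    finally have "infdist \<sigma> K \<le> norm f + \<bar>c\<bar> * (norm g + onorm A * norm f)"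
      by (simp add: mult_left_mono)
    also have "\<dots> \<le> (1 + \<bar>c\<bar> * (1 + onorm A)) * (norm g + norm f)"
    proof -
      have "0 \<le> norm g + \<bar>c\<bar> * (onorm A * norm g + norm f)"
        by (simp add: onorm_pos_le A_lin)
      thus ?thesis by (simp add: algebra_simps)
    qed
    finally show ?thesis .
  qed
  thus "well_posed_factor A P" unfolding well_posed_factor_def by blast
qed

end

theorem theorem4p1:
  fixes P A :: "'h::{real_inner, complete_space} \<Rightarrow> 'h"
  assumes "orthogonal_projector P"
    and "selfadjoint A"
    and "nonneg_op A"
  shows "(closed (range A + range P) \<longleftrightarrow> closed (A ` null_space P + range P))
       \<and> (closed (range A + range P) \<longleftrightarrow> closed (co_proj P ` range A))
       \<and> (closed (range A + range P) \<longleftrightarrow> closed (co_proj P ` A ` null_space P))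
       \<and> (closed (range A + range P) \<longleftrightarrow> well_posed_factor A P)
       \<and> (closed (range A + range P) \<longleftrightarrow> well_posed_normal A P)
       \<and> (\<forall>f g \<sigma>. normal_solution A P f g \<sigma> \<longleftrightarrow>
            solution A P f g \<sigma> \<and> \<sigma> \<in> closure (range A + range P))"
proof -
  interpret nonneg_op_with_projector P A using assms by unfold_locales
  have "closed (range A + range P) \<longleftrightarrow> closed (range T)"
    unfolding closed_plus_range_projector_iff[OF P]
    using closed_range_T_if_closed_range_QA closed_range_QA_if_closed_range_T by blast
  then show ?thesis
    unfolding well_posed_factor_iff_normal[symmetric] well_posed_factor_iff_closed_range_T
      closed_plus_range_projector_iff[OF P] range_T[symmetric]
      normal_solution_iff_orthogonal closure_range_plus
    by (intro conjI allI refl)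
qed

end
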